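(* Suppose that every sensor is connected to an anchor either directly or indirectly. For any initial point $(U^{(0)},V^{(0)})\in\mathbb{R}^{d\times m}\times\mathbb{R}^{d\times m}$ such that $U^{(0)}=V^{(0)}$, if the penalty parameter $\gamma>0$ satisfies $$\gamma > \frac{1}{2}\sqrt{2f(U^{(0)},V^{(0)})}\max_{1\le i\le m}\sqrt{4|E_{\mathrm{ss}}[i]|+|E_{\mathrm{sa}}[i]|},$$ then any accumulation point $(U^*,V^* )$ of the sequence $\{(U^{(p)},V^{(p)})\}_{p=1}^\infty$ generated by the block coordinate descent algorithm with this initial point and penalty parameter $\gamma$ satisfies $U^*=V^*$.
   Context: Setting (sensor network localization). Let $d,m,n$ be positive integers. Sensors are indexed by $1,\dots,m$ and anchors by $m+1,\dots,m+n$; anchor $k$ has known position $\bm{a}_k\in\mathbb{R}^d$. $E_{\mathrm{ss}}$ is a set of unordered pairs $ij=\{i,j\}$ of distinct sensors, and $E_{\mathrm{sa}}$ is a set of pairs $ik=\{i,k\}$ consisting of a sensor $i$ and an anchor $k$. For each $ij\in E_{\mathrm{ss}}$ and $ik\in E_{\mathrm{sa}}$, nonnegative real numbers $d_{ij}$ (symmetric in $i,j$) and $d_{ik}$ (measured distances) are given. For $i=1,\dots,m$, $E_{\mathrm{ss}}[i]=\{j: ij\in E_{\mathrm{ss}}\}$ and $E_{\mathrm{sa}}[i]=\{k: ik\in E_{\mathrm{sa}}\}$; $|\cdot|$ denotes cardinality. "Every sensor is connected to an anchor either directly or indirectly" means: in the graph with vertex set $\{1,\dots,m+n\}$ and edge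 set $E_{\mathrm{ss}}\cup E_{\mathrm{sa}}$, for every sensor there is a path from it to some anchor. For $U=(\bm{u}_1,\dots,\bm{u}_m)$ and $V=(\bm{v}_1,\dots,\bm{v}_m)$ in $\mathbb{R}^{d\times m}$ (columns $\bm{u}_i,\bm{v}_i\in\mathbb{R}^d$) define $$f(U,V) := \frac{1}{2}\sum_{ij\in E_{\mathrm{ss}}}\left((\bm{u}_i-\bm{u}_j)^\top(\bm{v}_i-\bm{v}_j)-d_{ij}^2\right)^2 + \frac{1}{2}\sum_{ik\in E_{\mathrm{sa}}}\left((\bm{a}_k-\bm{u}_i)^\top(\bm{a}_k-\bm{v}_i)-d_{ik}^2\right)^2,$$ $$F(U,V;\gamma) := \frac{\gamma}{2}\|U-V\|_F^2+f(U,V),$$ where $\|\cdot\|_F$ is the Frobenius norm. $F$ is written with the columns of $U$ and/or $V$ listed as separate arguments when convenient. Block coordinate descent algorithm (with fixed $\gamma>0$): given an initial point $(U^{(0)},V^{(0)})$, for $p=1,2,\dots$ compute, for $i=1,\dots,m$ in this order, $$\bm{u}_i^{(p)} = \mathop{\mathrm{argmin}}_{\bm{u}_i\in\mathbb{R}^d}F(\bm{u}_1^{(p)},\dots,\bm{u}_{i-1}^{(p)},\bm{u}_i,\bm{u}_{i+1}^{(p-1)},\dots,\bm{u}_m^{(p-1)},V^{(p-1)};\gamma),$$ and then, for $i=1,\dots,m$ in this order, $$\bm{v}_i^{(p)} = \mathop{\mathrm{argmin}}_{\bm{v}_i\in\mathbb{R}^d}F(U^{(p)},\bm{v}_1^{(p)},\dots,\bm{v}_{i-1}^{(p)},\bm{v}_i,\bm{v}_{i+1}^{(p-1)},\dots,\bm{v}_m^{(p-1)};\gamma),$$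 with $U^{(p)}=(\bm{u}_1^{(p)},\dots,\bm{u}_m^{(p)})$ and $V^{(p)}=(\bm{v}_1^{(p)},\dots,\bm{v}_m^{(p)})$ (each minimizer exists and is unique). The generated sequence is the infinite sequence obtained without applying any stopping test. *)

theory Defs
  imports "HOL-Analysis.Analysis"
begin

text \<open>
  Sensors are the elements of a finite linearly ordered type \<open>'m\<close> (the order is the one in which
  the sensors are processed), anchors those of a finite type \<open>'n\<close>. A matrix in
  \<open>\<real>\<^bsup>d\<times>m\<^esup>\<close> is stored column-wise as \<open>U :: real^'d^'m\<close>: \<open>U $ i\<close> is the \<open>i\<close>-th column, and
  \<open>norm U\<close> is the Frobenius norm. A sensor-anchor edge is the pair \<open>(i, k)\<close>; a sensor-sensor edge
  is the two-element set \<open>{i, j}\<close>.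
\<close>

definition ss_nbrs :: "'m set set \<Rightarrow> 'm \<Rightarrow> 'm set" where
  "ss_nbrs Ess i = {j. {i, j} \<in> Ess}"

definition sa_nbrs :: "('m \<times> 'n) set \<Rightarrow> 'm \<Rightarrow> 'n set" where
  "sa_nbrs Esa i = {k. (i, k) \<in> Esa}"

definition network_edges :: "'m set set \<Rightarrow> ('m \<times> 'n) set \<Rightarrow> ('m + 'n) set set" where
  "network_edges Ess Esa = {{Inl i, Inl j} | i j. {i, j} \<in> Ess} \<union> {{Inl i, Inr k} | i k. (i, k) \<in> Esa}"

definition sensors_connected :: "'m set set \<Rightarrow> ('m \<times> 'n) set \<Rightarrow> bool" where
  "sensors_connected Ess Esa \<longleftrightarrow>
     (\<forall>i. \<exists>k. (Inl i, Inr k) \<in> {(x, y). {x, y} \<in> network_edges Ess Esa}\<^sup>*)"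

text \<open>The condition \<open>i < j\<close> makes every unordered edge contribute exactly once.\<close>

definition snl_f ::
  "(real^'d^'n) \<Rightarrow> 'm set set \<Rightarrow> ('m \<times> 'n) set \<Rightarrow> ('m \<Rightarrow> 'm \<Rightarrow> real) \<Rightarrow> ('m \<Rightarrow> 'n \<Rightarrow> real) \<Rightarrow>
   (real^'d, 'm::{finite,linorder}) vec \<Rightarrow> (real^'d, 'm) vec \<Rightarrow> real" where
  "snl_f a Ess Esa dss dsa U V =
     1/2 * (\<Sum>(i, j) \<in> {(i, j). i < j \<and> {i, j} \<in> Ess}.
              ((U $ i - U $ j) \<bullet> (V $ i - V $ j) - (dss i j)\<^sup>2)\<^sup>2)
   + 1/2 * (\<Sum>(i, k) \<in> Esa. ((a $ k - U $ i) \<bullet> (a $ k - V $ i) - (dsa i k)\<^sup>2)\<^sup>2)"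

definition snl_F ::
  "(real^'d^'n) \<Rightarrow> 'm set set \<Rightarrow> ('m \<times> 'n) set \<Rightarrow> ('m \<Rightarrow> 'm \<Rightarrow> real) \<Rightarrow> ('m \<Rightarrow> 'n \<Rightarrow> real) \<Rightarrow>
   real \<Rightarrow> (real^'d, 'm::{finite,linorder}) vec \<Rightarrow> (real^'d, 'm) vec \<Rightarrow> real" where
  "snl_F a Ess Esa dss dsa \<gamma> U V = \<gamma>/2 * (norm (U - V))\<^sup>2 + snl_f a Ess Esa dss dsa U V"

definition splice_col ::
  "(real^'d, 'm::{finite,linorder}) vec \<Rightarrow> 'm \<Rightarrow> real^'d \<Rightarrow> (real^'d, 'm) vec \<Rightarrow> (real^'d, 'm) vec" where
  "splice_col W i x W' = (\<chi> j. if j < i then W $ j else if j = i then x else W' $ j)"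

text \<open>
  \<open>bcd_sequence G U V\<close>: the sequence \<open>(U p, V p)\<close>, started at the initial point \<open>(U 0, V 0)\<close>, is
  generated by block coordinate descent on the objective \<open>G\<close>.
\<close>

definition bcd_sequence ::
  "((real^'d, 'm::{finite,linorder}) vec \<Rightarrow> (real^'d, 'm) vec \<Rightarrow> real) \<Rightarrow>
   (nat \<Rightarrow> (real^'d, 'm) vec) \<Rightarrow> (nat \<Rightarrow> (real^'d, 'm) vec) \<Rightarrow> bool" where
  "bcd_sequence G U V \<longleftrightarrow>
     (\<forall>p i. is_arg_min (\<lambda>u. G (splice_col (U (Suc p)) i u (U p)) (V p)) (\<lambda>_. True) (U (Suc p) $ i)) \<and>
     (\<forall>p i. is_arg_min (\<lambda>v. G (U (Suc p)) (splice_col (V (Suc p)) i v (V p))) (\<lambda>_. True) (V (Suc p) $ i))"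

definition accumulation_point :: "(nat \<Rightarrow> 'a::topological_space) \<Rightarrow> 'a \<Rightarrow> bool" where
  "accumulation_point X x \<longleftrightarrow> (\<exists>r :: nat \<Rightarrow> nat. strict_mono r \<and> (X \<circ> r) \<longlonglongrightarrow> x)"

end

theory Submission
  imports Defs
begin

text \<open>
  Each residual \<open>r\<^sub>e(U,V)\<close> is affine in \<open>U\<close> and in \<open>V\<close> separately, so the penalty makes \<open>F\<close>
  a quadratic function of every single column with Hessian at least \<open>\<gamma>\<close>. Hence each column update
  decreases \<open>F\<close> by at least \<open>\<gamma>/2\<close> times the squared length of its step. As \<open>F\<close> is
  bounded below, the steps tend to zero, so all the intermediate points of a sweep share the limit of
  the subsequence, and at an accumulation point no single column can be improved
  (\<open>bcd_accumulation_point\<close>). Both partial gradients therefore vanish there, and \<open>F\<close> is at most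
  its initial value, which is \<open>f(U\<^bsup>(0)\<^esup>,V\<^bsup>(0)\<^esup>)\<close> because the two initial matrices agree.

  Write \<open>D\<^sub>e W\<close> for \<open>w\<^sub>i - w\<^sub>j\<close> on a sensor-sensor edge and \<open>w\<^sub>i\<close> on a sensor-anchor edge.
  Testing the two stationarity equations with \<open>W = U - V\<close> and subtracting them cancels
  the anchor positions outside the residuals and leaves
  \<open>2 \<gamma> \<parallel>W\<parallel>\<^sup>2 = \<Sum>\<^sub>e r\<^sub>e \<parallel>D\<^sub>e W\<parallel>\<^sup>2\<close>. By Cauchy-Schwarz the right-hand side is at most
  \<open>\<surd>(2 f) \<surd>(\<Sum>\<^sub>e \<parallel>D\<^sub>e W\<parallel>\<^sup>4)\<close>, and a counting argument at each sensor
  (\<open>weighted_edge_sum_le\<close>) bounds the last root by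
  \<open>max\<^sub>i \<surd>(4 |E\<^sub>s\<^sub>s[i]| + |E\<^sub>s\<^sub>a[i]|) \<parallel>W\<parallel>\<^sup>2\<close>. The assumed lower bound on \<open>\<gamma>\<close> makes the two sides
  incompatible unless \<open>W = 0\<close>.
\<close>

section \<open>Sums of squared bilinear residuals\<close>

lemma quadratic_nonneg_imp_linear_zero:
  fixes g q :: real
  assumes "\<And>t. 0 \<le> t * g + t\<^sup>2 * q" "q \<ge> 0"
  shows "g = 0"
proof (rule ccontr)
  assume "g \<noteq> 0"
  \<comment> \<open>The best step is \<open>-g / (2 q)\<close>; replacing the denominator by \<open>q + 1\<close> still makes the
    quadratic negative and covers \<open>q = 0\<close>.\<close>
  have "(-g / (q + 1)) * g + (-g / (q + 1))\<^sup>2 * q = - (g\<^sup>2 / (q + 1)\<^sup>2)"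
    using assms(2) by (simp add: divide_simps power2_eq_square) algebra
  moreover have "g\<^sup>2 / (q + 1)\<^sup>2 > 0"
    using \<open>g \<noteq> 0\<close> assms(2) by simp
  ultimately show False
    using assms(1)[of "-g / (q + 1)"] by linarith
qed

text \<open>
  The two kinds of edges enter the objective in the same way, through a linear map \<open>D e\<close> of the
  configuration and a constant offset \<open>b e\<close>, so one family of residuals covers both. The objective
  is symmetric in its two arguments, so it suffices to study its dependence on the first.
\<close>

locale bilinear_residuals =
  fixes E :: "'e set"
    and D :: "'e \<Rightarrow> 'x::real_inner \<Rightarrow> 'y::real_inner"
    and b :: "'e \<Rightarrow> 'y"
    and c :: "'e \<Rightarrow> real"
    and \<gamma> :: real
  assumes D: "\<And>e. bounded_linear (D e)"
    and \<gamma>_pos: "\<gamma> > 0"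
begin

definition resid :: "'e \<Rightarrow> 'x \<Rightarrow> 'x \<Rightarrow> real" where
  "resid e U V = (D e U - b e) \<bullet> (D e V - b e) - c e"

definition F :: "'x \<Rightarrow> 'x \<Rightarrow> real" where
  "F U V = \<gamma>/2 * (norm (U - V))\<^sup>2 + 1/2 * (\<Sum>e\<in>E. (resid e U V)\<^sup>2)"

text \<open>The derivative of \<open>\<lambda>U. F U V\<close> at \<open>U\<close> in direction \<open>H\<close>.\<close>

definition dF :: "'x \<Rightarrow> 'x \<Rightarrow> 'x \<Rightarrow> real" where
  "dF U V H = \<gamma> * ((U - V) \<bullet> H) + (\<Sum>e\<in>E. resid e U V * (D e H \<bullet> (D e V - b e)))"

lemma resid_commute: "resid e U V = resid e V U"
  by (simp add: resid_def inner_commute)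

lemma F_commute: "F U V = F V U"
  by (simp add: F_def norm_minus_commute resid_commute)

lemma F_nonneg: "0 \<le> F U V"
  using \<gamma>_pos by (simp add: F_def sum_nonneg)

lemma continuous_on_F: "continuous_on UNIV (\<lambda>(U, V). F U V)"
  unfolding F_def resid_def case_prod_unfold
  by (intro continuous_intros bounded_linear.continuous_on[OF D])

lemma linear_dF: "linear (dF U V)"
  by (rule linearI)
    (simp_all add: dF_def linear_add[OF bounded_linear.linear[OF D]]
      linear_scale[OF bounded_linear.linear[OF D]] inner_add_left inner_add_right distrib_left
      sum.distrib sum_distrib_left mult.left_commute)

text \<open>
  The expansion is exact, with no terms beyond second order, since the residuals are affine in their
  first argument; its quadratic part is at least \<open>\<gamma>/2 * (norm H)\<^sup>2\<close>.
\<close>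

lemma F_add:
  "F (U + H) V = F U V + dF U V H
     + (\<gamma>/2 * (norm H)\<^sup>2 + 1/2 * (\<Sum>e\<in>E. (D e H \<bullet> (D e V - b e))\<^sup>2))"
proof -
  have n: "(norm (U + H - V))\<^sup>2 = (norm (U - V))\<^sup>2 + 2 * ((U - V) \<bullet> H) + (norm H)\<^sup>2"
    by (simp add: power2_norm_eq_inner inner_simps inner_commute)
  have r: "resid e (U + H) V = resid e U V + D e H \<bullet> (D e V - b e)" for e
    by (simp add: resid_def linear_add[OF bounded_linear.linear[OF D]] inner_simps)
  define y where "y e = D e H \<bullet> (D e V - b e)" for e
  have s: "(\<Sum>e\<in>E. (resid e U V + y e)\<^sup>2)
      = (\<Sum>e\<in>E. (resid e U V)\<^sup>2) + (\<Sum>e\<in>E. (y e)\<^sup>2) + 2 * (\<Sum>e\<in>E. resid e U V * y e)"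
    by (simp add: power2_sum sum.distrib sum_distrib_left mult.assoc)
  show ?thesis
    unfolding F_def dF_def n r y_def[symmetric] s by (simp add: algebra_simps)
qed

lemma dF_zero_of_line_minimum:
  assumes "\<And>t. F U V \<le> F (U + t *\<^sub>R H) V"
  shows "dF U V H = 0"
proof (rule quadratic_nonneg_imp_linear_zero)
  define q where "q = \<gamma>/2 * (norm H)\<^sup>2 + 1/2 * (\<Sum>e\<in>E. (D e H \<bullet> (D e V - b e))\<^sup>2)"
  show "0 \<le> q"
    using \<gamma>_pos by (simp add: q_def sum_nonneg)
  show "0 \<le> t * dF U V H + t\<^sup>2 * q" for t
  proof -
    have "F (U + t *\<^sub>R H) V = F U V + t * dF U V H + t\<^sup>2 * q"
      unfolding F_add q_def linear_scale[OF linear_dF] linear_scale[OF bounded_linear.linear[OF D]]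
        norm_scaleR inner_scaleR_left power_mult_distrib power2_abs sum_distrib_left[symmetric]
      by (simp add: distrib_left)
    with assms[of t] show ?thesis by simp
  qed
qed

text \<open>
  At a minimum along the line only the quadratic part of the expansion survives. This is the
  sufficient decrease of one column update, read from its minimizer.
\<close>

lemma F_growth_at_line_minimum:
  assumes "\<And>t. F U V \<le> F (U + t *\<^sub>R H) V"
  shows "F U V + \<gamma>/2 * (norm H)\<^sup>2 \<le> F (U + H) V"
  unfolding F_add using dF_zero_of_line_minimum[OF assms] by (simp add: sum_nonneg)

text \<open>
  In \<open>dF V U W - dF U V W\<close> the residuals are the same, so the terms of the edge \<open>e\<close> combine to the
  residual times \<open>D e W \<bullet> (D e U - D e V)\<close>: the offsets cancel. The penalty terms add up because
  they have opposite signs.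
\<close>

lemma stationary_energy_identity:
  assumes "dF U V (U - V) = 0" "dF V U (U - V) = 0"
  shows "2 * \<gamma> * (norm (U - V))\<^sup>2 = (\<Sum>e\<in>E. resid e U V * (norm (D e (U - V)))\<^sup>2)"
proof -
  have "(\<Sum>e\<in>E. resid e U V * (norm (D e (U - V)))\<^sup>2)
      = (\<Sum>e\<in>E. resid e U V * (D e (U - V) \<bullet> (D e U - b e)))
        - (\<Sum>e\<in>E. resid e U V * (D e (U - V) \<bullet> (D e V - b e)))"
    unfolding sum_subtractf[symmetric]
    by (intro sum.cong refl)
      (simp add: power2_norm_eq_inner linear_diff[OF bounded_linear.linear[OF D]] inner_simps
        algebra_simps)
  also have "\<dots> = (dF V U (U - V) - \<gamma> * ((V - U) \<bullet> (U - V)))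
      - (dF U V (U - V) - \<gamma> * ((U - V) \<bullet> (U - V)))"
    by (simp add: dF_def resid_commute[of _ V U])
  also have "\<dots> = 2 * \<gamma> * (norm (U - V))\<^sup>2"
    using assms by (simp add: power2_norm_eq_inner inner_simps algebra_simps)
  finally show ?thesis ..
qed

text \<open>
  Cauchy-Schwarz separates the residuals, controlled by the value of \<open>F\<close>, from the geometry of
  the network, which enters only through \<open>K\<close>.
\<close>

lemma stationary_imp_eq:
  assumes "dF U V (U - V) = 0" "dF V U (U - V) = 0"
    and bound: "\<And>W. (\<Sum>e\<in>E. ((norm (D e W))\<^sup>2)\<^sup>2) \<le> (K * (norm W)\<^sup>2)\<^sup>2"
    and "K \<ge> 0" and F0: "F U V \<le> F0" and gap: "sqrt (2 * F0) * K < 2 * \<gamma>"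
  shows "U = V"
proof (rule ccontr)
  assume "U \<noteq> V"
  define W where "W = U - V"
  have W: "(norm W)\<^sup>2 > 0"
    using \<open>U \<noteq> V\<close> by (simp add: W_def)
  have "(\<Sum>e\<in>E. (resid e U V)\<^sup>2) \<le> 2 * F0"
  proof -
    have "0 \<le> \<gamma>/2 * (norm (U - V))\<^sup>2"
      using \<gamma>_pos by simp
    then show ?thesis
      using F0 unfolding F_def by linarith
  qed
  then have res: "L2_set (\<lambda>e. resid e U V) E \<le> sqrt (2 * F0)"
    unfolding L2_set_def by (rule real_sqrt_le_mono)
  have dir: "L2_set (\<lambda>e. (norm (D e W))\<^sup>2) E \<le> K * (norm W)\<^sup>2"
    unfolding L2_set_def using bound \<open>K \<ge> 0\<close> by (intro real_le_lsqrt) (auto simp: sum_nonneg)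
  have "2 * \<gamma> * (norm W)\<^sup>2 = (\<Sum>e\<in>E. resid e U V * (norm (D e W))\<^sup>2)"
    unfolding W_def using assms(1,2) by (rule stationary_energy_identity)
  also have "\<dots> \<le> (\<Sum>e\<in>E. \<bar>resid e U V\<bar> * \<bar>(norm (D e W))\<^sup>2\<bar>)"
    by (intro sum_mono) (simp add: mult_right_mono)
  also have "\<dots> \<le> L2_set (\<lambda>e. resid e U V) E * L2_set (\<lambda>e. (norm (D e W))\<^sup>2) E"
    by (rule L2_set_mult_ineq)
  also have "\<dots> \<le> sqrt (2 * F0) * (K * (norm W)\<^sup>2)"
    using F_nonneg[of U V] F0 by (intro mult_mono res dir) auto
  also have "\<dots> < 2 * \<gamma> * (norm W)\<^sup>2"
    using mult_strict_right_mono[OF gap W] by (simp add: mult.assoc)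
  finally show False by simp
qed

end

section \<open>Limits of block coordinate descent\<close>

lemma scaleR_axis: "t *\<^sub>R axis i h = axis i (t *\<^sub>R h)" for h :: "'a::real_vector"
  by (simp add: vec_eq_iff axis_def)

lemma splice_col_add_axis:
  "splice_col W i x W' + axis i h = splice_col W i (x + h) W'"
  by (simp add: vec_eq_iff splice_col_def axis_def)

lemma splice_col_self: "splice_col W i (W $ i) W = W"
  by (simp add: vec_eq_iff splice_col_def)

text \<open>
  The columns of a sweep are replaced in increasing order, so the matrices occurring in it are the
  mixtures of \<open>x\<close> and \<open>y\<close> that take the columns in a down-closed set from \<open>y\<close>. Induction
  over these sets telescopes the decreases of the single steps.
\<close>

lemma sweep_decrease:
  fixes g :: "(real^'d, 'm::{finite,linorder}) vec \<Rightarrow> real"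
  assumes step: "\<And>i. g (splice_col y i (y $ i) x) + c * (norm (y $ i - x $ i))\<^sup>2
                   \<le> g (splice_col y i (x $ i) x)"
  shows "g y + c * (norm (y - x))\<^sup>2 \<le> g x"
proof -
  define Z where "Z S = (\<chi> j. if j \<in> S then y $ j else x $ j)" for S :: "'m set"
  have "(\<forall>i\<in>S. \<forall>j<i. j \<in> S) \<longrightarrow> g (Z S) + c * (\<Sum>i\<in>S. (norm (y $ i - x $ i))\<^sup>2) \<le> g x"
    for S :: "'m set"
    using finite[of S]
  proof (induction rule: finite_linorder_max_induct)
    case empty
    have "Z {} = x" by (simp add: Z_def vec_eq_iff)
    then show ?case by simp
  next
    case (insert k S)
    show ?case
    proof
      assume down: "\<forall>i\<in>insert k S. \<forall>j<i. j \<in> insert k S"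
      have S: "S = {j. j < k}"
        using down insert.hyps by auto
      have "Z (insert k S) = splice_col y k (y $ k) x" "Z S = splice_col y k (x $ k) x"
        by (auto simp: Z_def splice_col_def vec_eq_iff S)
      moreover have "\<forall>i\<in>S. \<forall>j<i. j \<in> S"
        unfolding S by auto
      ultimately show "g (Z (insert k S)) + c * (\<Sum>i\<in>insert k S. (norm (y $ i - x $ i))\<^sup>2) \<le> g x"
        using insert step[of k] by (auto simp: algebra_simps)
    qed
  qed
  from this[of UNIV] have "g (Z UNIV) + c * (\<Sum>i\<in>UNIV. (norm (y $ i - x $ i))\<^sup>2) \<le> g x"
    by simp
  moreover have "Z UNIV = y"
    by (simp add: Z_def vec_eq_iff)
  moreover have "(norm (y - x))\<^sup>2 = (\<Sum>i\<in>UNIV. (norm (y $ i - x $ i))\<^sup>2)"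
    by (simp add: norm_vec_def L2_set_def sum_nonneg)
  ultimately show ?thesis by simp
qed

lemma splice_col_tendsto:
  assumes "(X \<longlongrightarrow> x) \<F>" "(f \<longlongrightarrow> u) \<F>" "(Y \<longlongrightarrow> y) \<F>"
  shows "((\<lambda>n. splice_col (X n) i (f n) (Y n)) \<longlongrightarrow> splice_col x i u y) \<F>"
proof (rule vec_tendstoI)
  fix j
  show "((\<lambda>n. splice_col (X n) i (f n) (Y n) $ j) \<longlongrightarrow> splice_col x i u y $ j) \<F>"
    using assms by (auto simp: splice_col_def intro: tendsto_vec_nth)
qed

lemma tendsto_subseq_shift:
  fixes X :: "nat \<Rightarrow> 'a::real_normed_vector"
  assumes diff: "(\<lambda>p. X (Suc p) - X p) \<longlonglongrightarrow> 0"
    and r: "strict_mono r" and X: "(\<lambda>n. X (r n)) \<longlonglongrightarrow> x"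
  shows "(\<lambda>n. X (Suc (r n))) \<longlonglongrightarrow> x"
proof -
  have "(\<lambda>n. X (Suc (r n)) - X (r n)) \<longlonglongrightarrow> 0"
    using LIMSEQ_subseq_LIMSEQ[OF diff r] by (simp add: o_def)
  from tendsto_add[OF X this] show ?thesis by simp
qed

lemma tendsto_zero_of_sq_le:
  fixes X :: "nat \<Rightarrow> 'a::real_normed_vector"
  assumes "c > 0" "\<And>n. c * (norm (X n))\<^sup>2 \<le> e n" "e \<longlonglongrightarrow> 0"
  shows "X \<longlonglongrightarrow> 0"
proof -
  have "(\<lambda>n. (norm (X n))\<^sup>2) \<longlonglongrightarrow> 0"
  proof (rule tendsto_sandwich[of "\<lambda>_. 0" _ _ "\<lambda>n. e n / c"])
    show "(\<lambda>n. e n / c) \<longlonglongrightarrow> 0"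
      using tendsto_divide[OF assms(3) tendsto_const[of c]] assms(1) by simp
    show "\<forall>\<^sub>F n in sequentially. (norm (X n))\<^sup>2 \<le> e n / c"
      using assms(1,2) by (simp add: field_simps)
  qed auto
  from tendsto_real_sqrt[OF this] show ?thesis
    by (simp add: tendsto_norm_zero_iff)
qed

text \<open>
  The minimality of each update is an inequality between values of \<open>G\<close> at matrices spliced from
  consecutive iterates. Since consecutive iterates have the same limit along the subsequence, it
  passes to the limit, where the splices disappear. The quadratic growth of \<open>G\<close> from columnwise
  minima is what forces the distance of consecutive iterates to zero.
\<close>

lemma bcd_accumulation_point:
  fixes G :: "(real^'d, 'm::{finite,linorder}) vec \<Rightarrow> (real^'d, 'm) vec \<Rightarrow> real"
  assumes bcd: "bcd_sequence G U V"
    and accum: "accumulation_point (\<lambda>p. (U p, V p)) (x, y)"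
    and cont: "continuous_on UNIV (\<lambda>(u, v). G u v)"
    and nonneg: "\<And>u v. 0 \<le> G u v"
    and "\<kappa> > 0"
    and growthU: "\<And>u v i h. (\<And>h'. G u v \<le> G (u + axis i h') v) \<Longrightarrow>
                    G u v + \<kappa> * (norm h)\<^sup>2 \<le> G (u + axis i h) v"
    and growthV: "\<And>u v i h. (\<And>h'. G u v \<le> G u (v + axis i h')) \<Longrightarrow>
                    G u v + \<kappa> * (norm h)\<^sup>2 \<le> G u (v + axis i h)"
  shows "G x y \<le> G (x + axis i h) y" "G x y \<le> G x (y + axis i h)" "G x y \<le> G (U 0) (V 0)"
proof -
  have minU: "G (splice_col (U (Suc p)) i (U (Suc p) $ i) (U p)) (V p)
              \<le> G (splice_col (U (Suc p)) i u (U p)) (V p)" for p i u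
    using bcd by (auto simp: bcd_sequence_def is_arg_min_linorder)
  have minV: "G (U (Suc p)) (splice_col (V (Suc p)) i (V (Suc p) $ i) (V p))
              \<le> G (U (Suc p)) (splice_col (V (Suc p)) i v (V p))" for p i v
    using bcd by (auto simp: bcd_sequence_def is_arg_min_linorder)
  have decU: "G (U (Suc p)) (V p) + \<kappa> * (norm (U (Suc p) - U p))\<^sup>2 \<le> G (U p) (V p)" for p
  proof (rule sweep_decrease)
    fix i
    show "G (splice_col (U (Suc p)) i (U (Suc p) $ i) (U p)) (V p)
          + \<kappa> * (norm (U (Suc p) $ i - U p $ i))\<^sup>2
          \<le> G (splice_col (U (Suc p)) i (U p $ i) (U p)) (V p)"
      using growthU[of "splice_col (U (Suc p)) i (U (Suc p) $ i) (U p)" "V p" i "U p $ i - U (Suc p) $ i"]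
      by (simp add: minU splice_col_add_axis norm_minus_commute)
  qed
  have decV: "G (U (Suc p)) (V (Suc p)) + \<kappa> * (norm (V (Suc p) - V p))\<^sup>2 \<le> G (U (Suc p)) (V p)" for p
  proof (rule sweep_decrease)
    fix i
    show "G (U (Suc p)) (splice_col (V (Suc p)) i (V (Suc p) $ i) (V p))
          + \<kappa> * (norm (V (Suc p) $ i - V p $ i))\<^sup>2
          \<le> G (U (Suc p)) (splice_col (V (Suc p)) i (V p $ i) (V p))"
      using growthV[of "U (Suc p)" "splice_col (V (Suc p)) i (V (Suc p) $ i) (V p)" i "V p $ i - V (Suc p) $ i"]
      by (simp add: minV splice_col_add_axis norm_minus_commute)
  qed
  define g where "g p = G (U p) (V p)" for p
  have dec: "\<kappa> * (norm (U (Suc p) - U p))\<^sup>2 \<le> g p - g (Suc p)"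
            "\<kappa> * (norm (V (Suc p) - V p))\<^sup>2 \<le> g p - g (Suc p)" for p
  proof -
    have "0 \<le> \<kappa> * (norm (U (Suc p) - U p))\<^sup>2" "0 \<le> \<kappa> * (norm (V (Suc p) - V p))\<^sup>2"
      using \<open>\<kappa> > 0\<close> by simp_all
    with decU[of p] decV[of p] show "\<kappa> * (norm (U (Suc p) - U p))\<^sup>2 \<le> g p - g (Suc p)"
      "\<kappa> * (norm (V (Suc p) - V p))\<^sup>2 \<le> g p - g (Suc p)"
      unfolding g_def by linarith+
  qed
  have "g (Suc p) \<le> g p" for p
  proof -
    have "0 \<le> \<kappa> * (norm (U (Suc p) - U p))\<^sup>2"
      using \<open>\<kappa> > 0\<close> by simp
    with dec(1)[of p] show ?thesis by linarith
  qed
  then have decseq: "decseq g" by (rule decseq_SucI)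
  obtain l where l: "g \<longlonglongrightarrow> l"
    using decseq_convergent[OF decseq, of 0] nonneg unfolding g_def by metis
  have "(\<lambda>p. g p - g (Suc p)) \<longlonglongrightarrow> 0"
    using tendsto_diff[OF l LIMSEQ_Suc[OF l]] by simp
  then have zero: "(\<lambda>p. U (Suc p) - U p) \<longlonglongrightarrow> 0" "(\<lambda>p. V (Suc p) - V p) \<longlonglongrightarrow> 0"
    by (rule tendsto_zero_of_sq_le[OF \<open>\<kappa> > 0\<close> dec(1)],
        rule tendsto_zero_of_sq_le[OF \<open>\<kappa> > 0\<close> dec(2)])
  obtain r where r: "strict_mono r" and lim: "(\<lambda>n. (U (r n), V (r n))) \<longlonglongrightarrow> (x, y)"
    using accum by (auto simp: accumulation_point_def o_def)
  have Ur: "(\<lambda>n. U (r n)) \<longlonglongrightarrow> x" and Vr: "(\<lambda>n. V (r n)) \<longlonglongrightarrow> y"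
    using tendsto_fst[OF lim] tendsto_snd[OF lim] by simp_all
  have Us: "(\<lambda>n. U (Suc (r n))) \<longlonglongrightarrow> x" and Vs: "(\<lambda>n. V (Suc (r n))) \<longlonglongrightarrow> y"
    by (rule tendsto_subseq_shift[OF zero(1) r Ur], rule tendsto_subseq_shift[OF zero(2) r Vr])
  have G_tendsto: "(\<lambda>n. G (X n) (Y n)) \<longlonglongrightarrow> G u v" if "X \<longlonglongrightarrow> u" "Y \<longlonglongrightarrow> v" for X Y u v
    using continuous_on_tendsto_compose[OF cont tendsto_Pair[OF that]] by simp
  have shift: "splice_col w i (w $ i + h) w = w + axis i h" for w :: "(real^'d, 'm) vec" and i h
    using splice_col_add_axis[of w i "w $ i" w h] by (simp add: splice_col_self)
  let ?u = "\<lambda>n. U (Suc (r n))" and ?v = "\<lambda>n. V (Suc (r n))"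
  let ?Ucol = "\<lambda>n z. splice_col (?u n) i z (U (r n))"
    and ?Vcol = "\<lambda>n z. splice_col (?v n) i z (V (r n))"
  have "G (splice_col x i (x $ i) x) y \<le> G (splice_col x i (x $ i + h) x) y"
  proof (rule LIMSEQ_le)
    show "(\<lambda>n. G (?Ucol n (?u n $ i)) (V (r n))) \<longlonglongrightarrow> G (splice_col x i (x $ i) x) y"
      by (intro G_tendsto splice_col_tendsto tendsto_vec_nth Us Ur Vr)
    show "(\<lambda>n. G (?Ucol n (x $ i + h)) (V (r n))) \<longlonglongrightarrow> G (splice_col x i (x $ i + h) x) y"
      by (intro G_tendsto splice_col_tendsto tendsto_const Us Ur Vr)
    show "\<exists>N. \<forall>n\<ge>N. G (?Ucol n (?u n $ i)) (V (r n)) \<le> G (?Ucol n (x $ i + h)) (V (r n))"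
      using minU by blast
  qed
  then show "G x y \<le> G (x + axis i h) y"
    by (simp add: splice_col_self shift)
  have "G x (splice_col y i (y $ i) y) \<le> G x (splice_col y i (y $ i + h) y)"
  proof (rule LIMSEQ_le)
    show "(\<lambda>n. G (?u n) (?Vcol n (?v n $ i))) \<longlonglongrightarrow> G x (splice_col y i (y $ i) y)"
      by (intro G_tendsto splice_col_tendsto tendsto_vec_nth Us Vs Vr)
    show "(\<lambda>n. G (?u n) (?Vcol n (y $ i + h))) \<longlonglongrightarrow> G x (splice_col y i (y $ i + h) y)"
      by (intro G_tendsto splice_col_tendsto tendsto_const Us Vs Vr)
    show "\<exists>N. \<forall>n\<ge>N. G (?u n) (?Vcol n (?v n $ i)) \<le> G (?u n) (?Vcol n (y $ i + h))"
      using minV by blast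
  qed
  then show "G x y \<le> G x (y + axis i h)"
    by (simp add: splice_col_self shift)
  show "G x y \<le> G (U 0) (V 0)"
  proof (rule LIMSEQ_le_const2[OF G_tendsto[OF Ur Vr]])
    show "\<exists>N. \<forall>n\<ge>N. G (U (r n)) (V (r n)) \<le> G (U 0) (V 0)"
      using decseqD[OF decseq] unfolding g_def by blast
  qed
qed

section \<open>The degree bound\<close>

lemma sum_ordered_edges:
  fixes Ess :: "('m::{finite,linorder}) set set" and g :: "'m \<Rightarrow> 'm \<Rightarrow> real"
  assumes "\<And>i. {i, i} \<notin> Ess"
  shows "(\<Sum>(i, j)\<in>{(i, j). i < j \<and> {i, j} \<in> Ess}. g i j + g j i)
         = (\<Sum>i\<in>UNIV. \<Sum>j\<in>ss_nbrs Ess i. g i j)"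
proof -
  let ?L = "{(i, j). i < j \<and> {i, j} \<in> Ess}"
  have "(\<Sum>i\<in>UNIV. \<Sum>j\<in>ss_nbrs Ess i. g i j) = (\<Sum>(i, j)\<in>Sigma UNIV (ss_nbrs Ess). g i j)"
    by (rule sum.Sigma) auto
  also have "Sigma UNIV (ss_nbrs Ess) = ?L \<union> prod.swap ` ?L"
  proof -
    have "i < j \<or> j < i" if "{i, j} \<in> Ess" for i j
      using that assms[of i] by (cases i j rule: linorder_cases) auto
    then have "(i, j) \<in> ?L \<union> prod.swap ` ?L" if "{i, j} \<in> Ess" for i j
      using that by (force simp: insert_commute image_iff)
    then have "Sigma UNIV (ss_nbrs Ess) \<subseteq> ?L \<union> prod.swap ` ?L"
      unfolding ss_nbrs_def by blast
    moreover have "?L \<union> prod.swap ` ?L \<subseteq> Sigma UNIV (ss_nbrs Ess)"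
      by (auto simp: ss_nbrs_def insert_commute)
    ultimately show ?thesis
      by (rule equalityI)
  qed
  also have "(\<Sum>(i, j)\<in>?L \<union> prod.swap ` ?L. g i j)
             = (\<Sum>(i, j)\<in>?L. g i j) + (\<Sum>(i, j)\<in>prod.swap ` ?L. g i j)"
    by (rule sum.union_disjoint) auto
  also have "(\<Sum>(i, j)\<in>prod.swap ` ?L. g i j) = (\<Sum>(i, j)\<in>?L. g j i)"
    by (subst sum.reindex) (auto simp: inj_on_def case_prod_unfold)
  finally show ?thesis
    by (simp add: sum.distrib case_prod_unfold)
qed

text \<open>
  Writing \<open>(x i + x j)\<^sup>2 = x i * (x i + x j) + x j * (x j + x i)\<close> distributes the sum over the
  sensors, so it suffices to bound the coefficient of each \<open>x i\<close> by \<open>M\<close> times the total weight.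
  Its diagonal part is \<open>(4 * deg + anchors) * x i \<le> M * x i\<close>. Its off-diagonal part has coefficients
  \<open>4\<close>, and \<open>4 \<le> M\<close> as soon as the sensor has a neighbour at all. Applied to \<open>x i = \<parallel>w\<^sub>i\<parallel>\<^sup>2\<close>, this
  yields the factor \<open>4\<close> per sensor neighbour; estimating \<open>(x i + x j)\<^sup>2 \<le> 2 * ((x i)\<^sup>2 + (x j)\<^sup>2)\<close>
  edge by edge would give \<open>8\<close>.
\<close>

lemma weighted_edge_sum_le:
  fixes Ess :: "('m::{finite,linorder}) set set" and Esa :: "('m \<times> 'n::finite) set"
    and x :: "'m \<Rightarrow> real"
  assumes loopfree: "\<And>i. {i, i} \<notin> Ess"
    and x: "\<And>i. x i \<ge> 0"
    and M: "\<And>i. 4 * real (card (ss_nbrs Ess i)) + real (card (sa_nbrs Esa i)) \<le> M"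
  shows "(\<Sum>(i, j)\<in>{(i, j). i < j \<and> {i, j} \<in> Ess}. 4 * (x i + x j)\<^sup>2) + (\<Sum>(i, k)\<in>Esa. (x i)\<^sup>2)
         \<le> M * (\<Sum>i\<in>UNIV. x i)\<^sup>2"
proof -
  let ?S = "\<Sum>i\<in>UNIV. x i"
  have node: "4 * (\<Sum>j\<in>ss_nbrs Ess i. x i + x j) + real (card (sa_nbrs Esa i)) * x i \<le> M * ?S" for i
  proof -
    have "4 * (\<Sum>j\<in>ss_nbrs Ess i. x j) \<le> M * (\<Sum>j\<in>UNIV - {i}. x j)"
    proof (cases "ss_nbrs Ess i = {}")
      case True
      have "M \<ge> 0" using M[of i] by linarith
      then show ?thesis using True x by (simp add: sum_nonneg)
    next
      case False
      then have "card (ss_nbrs Ess i) \<ge> 1"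
        by (simp add: Suc_le_eq card_gt_0_iff)
      then have "M \<ge> 4" using M[of i] by linarith
      moreover have "(\<Sum>j\<in>ss_nbrs Ess i. x j) \<le> (\<Sum>j\<in>UNIV - {i}. x j)"
        using x loopfree by (intro sum_mono2) (auto simp: ss_nbrs_def)
      ultimately show ?thesis
        using x by (intro mult_mono) (auto simp: sum_nonneg)
    qed
    moreover have "(4 * real (card (ss_nbrs Ess i)) + real (card (sa_nbrs Esa i))) * x i \<le> M * x i"
      using M x by (intro mult_right_mono)
    moreover have "?S = x i + (\<Sum>j\<in>UNIV - {i}. x j)"
      by (simp add: sum.remove)
    ultimately show ?thesis
      by (simp add: sum.distrib algebra_simps)
  qed
  have "(\<Sum>(i, j)\<in>{(i, j). i < j \<and> {i, j} \<in> Ess}. 4 * (x i + x j)\<^sup>2)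
      = (\<Sum>(i, j)\<in>{(i, j). i < j \<and> {i, j} \<in> Ess}. 4 * (x i * (x i + x j)) + 4 * (x j * (x j + x i)))"
    by (intro sum.cong) (auto simp: power2_eq_square algebra_simps)
  also have "\<dots> = (\<Sum>i\<in>UNIV. \<Sum>j\<in>ss_nbrs Ess i. 4 * (x i * (x i + x j)))"
    using loopfree by (rule sum_ordered_edges)
  also have "\<dots> = (\<Sum>i\<in>UNIV. x i * (4 * (\<Sum>j\<in>ss_nbrs Ess i. x i + x j)))"
    by (simp add: sum_distrib_left mult.left_commute)
  finally have ss: "(\<Sum>(i, j)\<in>{(i, j). i < j \<and> {i, j} \<in> Ess}. 4 * (x i + x j)\<^sup>2) = \<dots>" .
  have "Esa = Sigma UNIV (sa_nbrs Esa)"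
    by (auto simp: sa_nbrs_def)
  then have "(\<Sum>(i, k)\<in>Esa. (x i)\<^sup>2) = (\<Sum>(i, k)\<in>Sigma UNIV (sa_nbrs Esa). (x i)\<^sup>2)"
    by simp
  also have "\<dots> = (\<Sum>i\<in>UNIV. \<Sum>k\<in>sa_nbrs Esa i. (x i)\<^sup>2)"
    by (rule sum.Sigma[symmetric]) auto
  also have "\<dots> = (\<Sum>i\<in>UNIV. x i * (real (card (sa_nbrs Esa i)) * x i))"
    by (simp add: power2_eq_square algebra_simps)
  finally have "(\<Sum>(i, j)\<in>{(i, j). i < j \<and> {i, j} \<in> Ess}. 4 * (x i + x j)\<^sup>2) + (\<Sum>(i, k)\<in>Esa. (x i)\<^sup>2)
      = (\<Sum>i\<in>UNIV. x i * (4 * (\<Sum>j\<in>ss_nbrs Ess i. x i + x j) + real (card (sa_nbrs Esa i)) * x i))"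
    using ss by (simp add: sum.distrib distrib_left)
  also have "\<dots> \<le> (\<Sum>i\<in>UNIV. x i * (M * ?S))"
    using node x by (intro sum_mono mult_left_mono)
  also have "\<dots> = M * ?S\<^sup>2"
    by (simp add: sum_distrib_right[symmetric] power2_eq_square)
  finally show ?thesis .
qed

lemma norm_diff_squared_le:
  fixes u v :: "'a::real_inner"
  shows "(norm (u - v))\<^sup>2 \<le> 2 * ((norm u)\<^sup>2 + (norm v)\<^sup>2)"
  using zero_le_power2[of "norm (u + v)"]
  by (simp add: power2_norm_eq_inner inner_simps inner_commute)

section \<open>The localization objective\<close>

fun edge_map :: "('m \<times> 'm) + ('m \<times> 'n) \<Rightarrow> (real^'d, 'm::finite) vec \<Rightarrow> real^'d" where
  "edge_map (Inl e) W = W $ fst e - W $ snd e"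
| "edge_map (Inr e) W = W $ fst e"

fun edge_offset :: "(real^'d^'n) \<Rightarrow> ('m \<times> 'm) + ('m \<times> 'n) \<Rightarrow> real^'d" where
  "edge_offset a (Inl e) = 0"
| "edge_offset a (Inr e) = a $ snd e"

fun edge_target :: "('m \<Rightarrow> 'm \<Rightarrow> real) \<Rightarrow> ('m \<Rightarrow> 'n \<Rightarrow> real) \<Rightarrow> ('m \<times> 'm) + ('m \<times> 'n) \<Rightarrow> real" where
  "edge_target dss dsa (Inl e) = (dss (fst e) (snd e))\<^sup>2"
| "edge_target dss dsa (Inr e) = (dsa (fst e) (snd e))\<^sup>2"

definition edge_set ::
  "('m::linorder) set set \<Rightarrow> ('m \<times> 'n) set \<Rightarrow> (('m \<times> 'm) + ('m \<times> 'n)) set" where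
  "edge_set Ess Esa = {(i, j). i < j \<and> {i, j} \<in> Ess} <+> Esa"

lemma bounded_linear_edge_map: "bounded_linear (edge_map e)"
proof -
  have "linear (edge_map e)"
    by (rule linearI; cases e; auto simp: algebra_simps)
  then show ?thesis
    by (rule linear_conv_bounded_linear[THEN iffD1])
qed

lemma edge_map_fourth_power_sum_le:
  fixes Ess :: "('m::{finite,linorder}) set set" and Esa :: "('m \<times> 'n::finite) set"
    and W :: "(real^'d, 'm) vec"
  assumes loopfree: "\<And>i. {i, i} \<notin> Ess"
    and M: "\<And>i. 4 * real (card (ss_nbrs Ess i)) + real (card (sa_nbrs Esa i)) \<le> M"
  shows "(\<Sum>e\<in>edge_set Ess Esa. ((norm (edge_map e W))\<^sup>2)\<^sup>2) \<le> M * ((norm W)\<^sup>2)\<^sup>2"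
proof -
  let ?L = "{(i, j). i < j \<and> {i, j} \<in> Ess}"
  have "(\<Sum>e\<in>edge_set Ess Esa. ((norm (edge_map e W))\<^sup>2)\<^sup>2)
      = (\<Sum>(i, j)\<in>?L. ((norm (W $ i - W $ j))\<^sup>2)\<^sup>2) + (\<Sum>(i, k)\<in>Esa. ((norm (W $ i))\<^sup>2)\<^sup>2)"
    by (simp add: edge_set_def sum.Plus case_prod_unfold)
  also have "\<dots> \<le> (\<Sum>(i, j)\<in>?L. 4 * ((norm (W $ i))\<^sup>2 + (norm (W $ j))\<^sup>2)\<^sup>2)
                  + (\<Sum>(i, k)\<in>Esa. ((norm (W $ i))\<^sup>2)\<^sup>2)"
  proof (intro add_right_mono sum_mono, clarify)
    fix i j
    have "((norm (W $ i - W $ j))\<^sup>2)\<^sup>2 \<le> (2 * ((norm (W $ i))\<^sup>2 + (norm (W $ j))\<^sup>2))\<^sup>2"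
      by (intro power_mono norm_diff_squared_le) simp
    then show "((norm (W $ i - W $ j))\<^sup>2)\<^sup>2 \<le> 4 * ((norm (W $ i))\<^sup>2 + (norm (W $ j))\<^sup>2)\<^sup>2"
      by (simp only: power_mult_distrib) simp
  qed
  also have "\<dots> \<le> M * (\<Sum>i\<in>UNIV. (norm (W $ i))\<^sup>2)\<^sup>2"
    using loopfree M by (intro weighted_edge_sum_le) auto
  also have "(\<Sum>i\<in>UNIV. (norm (W $ i))\<^sup>2) = (norm W)\<^sup>2"
    by (simp add: norm_vec_def L2_set_def sum_nonneg)
  finally show ?thesis .
qed

theorem theorem4:
  fixes a :: "real^'d^'n"
    and Ess :: "('m::{finite,linorder}) set set"
    and Esa :: "('m \<times> 'n) set"
    and dss :: "'m \<Rightarrow> 'm \<Rightarrow> real"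
    and dsa :: "'m \<Rightarrow> 'n \<Rightarrow> real"
    and \<gamma> :: real
    and U V :: "nat \<Rightarrow> (real^'d, 'm) vec"
    and Ustar Vstar :: "(real^'d, 'm) vec"
  assumes Ess: "\<And>e. e \<in> Ess \<Longrightarrow> \<exists>i j. i \<noteq> j \<and> e = {i, j}"
    and dss_sym: "\<And>i j. {i, j} \<in> Ess \<Longrightarrow> dss i j = dss j i"
    and dss_nonneg: "\<And>i j. {i, j} \<in> Ess \<Longrightarrow> dss i j \<ge> 0"
    and dsa_nonneg: "\<And>i k. (i, k) \<in> Esa \<Longrightarrow> dsa i k \<ge> 0"
    and connected: "sensors_connected Ess Esa"
    and init: "U 0 = V 0"
    and gamma_pos: "\<gamma> > 0"
    and gamma: "\<gamma> > 1/2 * sqrt (2 * snl_f a Ess Esa dss dsa (U 0) (V 0)) *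
      (MAX i. sqrt (4 * real (card (ss_nbrs Ess i)) + real (card (sa_nbrs Esa i))))"
    and bcd: "bcd_sequence (snl_F a Ess Esa dss dsa \<gamma>) U V"
    and accum: "accumulation_point (\<lambda>p. (U p, V p)) (Ustar, Vstar)"
  shows "Ustar = Vstar"
proof -
  interpret bilinear_residuals "edge_set Ess Esa" edge_map "edge_offset a" "edge_target dss dsa" \<gamma>
    by (rule bilinear_residuals.intro[OF bounded_linear_edge_map gamma_pos])
  have snl_F: "snl_F a Ess Esa dss dsa \<gamma> = F"
  proof (intro ext)
    fix X Y :: "(real^'d, 'm) vec"
    have "(a $ k - X $ i) \<bullet> (a $ k - Y $ i) = (X $ i - a $ k) \<bullet> (Y $ i - a $ k)" for i k
      by (simp add: inner_simps)
    then show "snl_F a Ess Esa dss dsa \<gamma> X Y = F X Y"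
      unfolding snl_F_def snl_f_def F_def resid_def
      by (simp add: edge_set_def sum.Plus case_prod_unfold distrib_left)
  qed
  have growthU: "F X Y + \<gamma>/2 * (norm h)\<^sup>2 \<le> F (X + axis i h) Y"
    if "\<And>h'. F X Y \<le> F (X + axis i h') Y" for X Y :: "(real^'d, 'm) vec" and i h
    using F_growth_at_line_minimum[of X Y "axis i h"] that
    by (simp add: scaleR_axis norm_eq_sqrt_inner inner_axis_axis)
  have growthV: "F X Y + \<gamma>/2 * (norm h)\<^sup>2 \<le> F X (Y + axis i h)"
    if "\<And>h'. F X Y \<le> F X (Y + axis i h')" for X Y :: "(real^'d, 'm) vec" and i h
    using growthU[of Y X i h] that by (simp add: F_commute[of X])
  \<comment> \<open>At the accumulation point no single column can be improved; by linearity of \<open>dF\<close> in the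
    direction this gives stationarity in all directions.\<close>
  note limit = bcd_accumulation_point[OF bcd[unfolded snl_F] accum continuous_on_F F_nonneg
      half_gt_zero[OF gamma_pos] growthU growthV]
  have dF_zero: "dF X Y W = 0" if "\<And>i h. F X Y \<le> F (X + axis i h) Y" for X Y W :: "(real^'d, 'm) vec"
  proof -
    have "dF X Y (axis i (W $ i)) = 0" for i
    proof (rule dF_zero_of_line_minimum)
      show "F X Y \<le> F (X + t *\<^sub>R axis i (W $ i)) Y" for t
        using that by (simp add: scaleR_axis)
    qed
    then have "dF X Y (\<Sum>i\<in>UNIV. axis i (W $ i)) = 0"
      by (simp add: linear_sum[OF linear_dF])
    moreover have "(\<Sum>i\<in>UNIV. axis i (W $ i)) = W"
      by (simp add: vec_eq_iff axis_def)
    ultimately show ?thesis by simp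
  qed
  define K where "K = (MAX i. sqrt (4 * real (card (ss_nbrs Ess i)) + real (card (sa_nbrs Esa i))))"
  have K: "sqrt (4 * real (card (ss_nbrs Ess i)) + real (card (sa_nbrs Esa i))) \<le> K" for i
    unfolding K_def by (rule Max_ge) auto
  have K0: "K \<ge> 0"
    by (rule order_trans[OF _ K]) simp
  have loopfree: "{i, i} \<notin> Ess" for i
    using Ess[of "{i, i}"] by (auto simp: doubleton_eq_iff)
  show ?thesis
  proof (rule stationary_imp_eq)
    show "dF Ustar Vstar (Ustar - Vstar) = 0"
      by (rule dF_zero) (rule limit)
    show "dF Vstar Ustar (Ustar - Vstar) = 0"
      by (rule dF_zero) (simp add: F_commute[of _ Ustar] limit)
    show "(\<Sum>e\<in>edge_set Ess Esa. ((norm (edge_map e W))\<^sup>2)\<^sup>2) \<le> (K * (norm W)\<^sup>2)\<^sup>2"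
      for W :: "(real^'d, 'm) vec"
      unfolding power_mult_distrib
      by (rule edge_map_fourth_power_sum_le[OF loopfree sqrt_le_D[OF K]])
    show "F Ustar Vstar \<le> snl_f a Ess Esa dss dsa (U 0) (V 0)"
      using limit(3) unfolding snl_F[symmetric] by (simp add: snl_F_def init)
    show "sqrt (2 * snl_f a Ess Esa dss dsa (U 0) (V 0)) * K < 2 * \<gamma>"
      using gamma by (simp add: K_def)
  qed (rule K0)
qed

end
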